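(* Let $G$ be a connected graph on $n$ vertices, of tree-depth at most $\mathit{td}$. Then $\delta(\mathcal{A}(G))\le 2\cdot\mathit{td}\cdot n$.
   Context: For a connected graph $G=(V,E)$, a search tree on $G$ is a rooted tree with vertex set $V$ defined recursively: its root is some vertex $r\in V$, and $r$ is joined to the roots of search trees on each connected component of $G-r$. The tubes of a search tree are the vertex sets of its subtrees. Two search trees on $G$ are related by a rotation if their sets of tubes have symmetric difference of size exactly two. The graph associahedron $\mathcal{A}(G)$ is a polytope whose skeleton is isomorphic to the graph on search trees of $G$ with adjacency given by rotations; $\delta(\mathcal{A}(G))$ is the diameter of this graph. The tree-depth of $G$ is the minimum height of a search tree on $G$, where a tree consisting of a single vertex has height one. *)

theory Defs
  imports "Graph_Theory.Graph_Theory" "HOL-Library.FSet"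
begin

text \<open>
  A finite simple undirected graph is a symmetric digraph satisfying the locale predicate
  \<^const>\<open>graph\<close>. The theory \<open>HOL.Topological_Spaces\<close> has its own constant
  \<open>connected\<close>, so the graph-theoretic one is always written qualified.
\<close>

definition components :: "('a, 'b) pre_digraph \<Rightarrow> ('a, 'b) pre_digraph set" where
  "components G = {C. pre_digraph.max_subgraph G Digraph_Component.connected C}"

text \<open>Rooted trees are unordered, hence a finite set of children.\<close>

datatype 'a rtree = Node (root: 'a) (children: "'a rtree fset")

primrec subtrees :: "'a rtree \<Rightarrow> 'a rtree set" where
  "subtrees (Node r ts) = insert (Node r ts) (\<Union> (fset (subtrees |`| ts)))"

primrec tree_height :: "'a rtree \<Rightarrow> nat" where
  "tree_height (Node r ts) = Suc (Max (insert 0 (fset (tree_height |`| ts))))"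

text \<open>
  The function \<open>t\<close> chooses one search tree for each component of \<open>G - r\<close>. It is
  automatically injective on components, since the root of \<open>t C\<close> is a vertex of \<open>C\<close>.
\<close>

inductive search_tree :: "('a, 'b) pre_digraph \<Rightarrow> 'a rtree \<Rightarrow> bool" where
  "\<lbrakk>Digraph_Component.connected G;
    r \<in> verts G;
    \<forall>C \<in> components (pre_digraph.del_vert G r). search_tree C (t C);
    fset ts = t ` components (pre_digraph.del_vert G r)\<rbrakk>
   \<Longrightarrow> search_tree G (Node r ts)"

text \<open>\<^const>\<open>set_rtree\<close> yields the set of all vertices of a tree.\<close>

definition tubes :: "'a rtree \<Rightarrow> 'a set set" where
  "tubes T = set_rtree ` subtrees T"

definition rotation :: "'a rtree \<Rightarrow> 'a rtree \<Rightarrow> bool" where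
  "rotation S T \<longleftrightarrow> card ((tubes S - tubes T) \<union> (tubes T - tubes S)) = 2"

definition rotation_graph :: "('a, 'b) pre_digraph \<Rightarrow> 'a rtree pair_pre_digraph" where
  "rotation_graph G =
     \<lparr>pverts = {T. search_tree G T},
      parcs = {(S, T). search_tree G S \<and> search_tree G T \<and> rotation S T}\<rparr>"

text \<open>
  Distances are counted in arcs, that is, every arc has cost \<open>1\<close>. The diameter of a graph
  that is not connected is \<open>\<infinity>\<close>, so a finite bound on the diameter entails connectedness.
\<close>

definition graph_diameter :: "('a, 'b) pre_digraph \<Rightarrow> ereal" where
  "graph_diameter G = (SUP u \<in> verts G. SUP v \<in> verts G. wf_digraph.\<mu> G (\<lambda>_. 1) u v)"

text \<open>
  The skeleton of the graph associahedron of \<open>G\<close> is, up to isomorphism, the rotation graph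
  on the search trees of \<open>G\<close>; its diameter is \<open>\<delta>(\<A>(G))\<close>.
\<close>

definition associahedron_diameter :: "('a, 'b) pre_digraph \<Rightarrow> ereal" where
  "associahedron_diameter G = graph_diameter (with_proj (rotation_graph G))"

definition tree_depth :: "('a, 'b) pre_digraph \<Rightarrow> nat" where
  "tree_depth G = (LEAST h. \<exists>T. search_tree G T \<and> tree_height T = h)"

lemma wf_digraph_rotation_graph: "wf_digraph (with_proj (rotation_graph G))"
  by unfold_locales (auto simp: rotation_graph_def)

end

theory Submission
  imports Defs "HOL-Library.Multiset"
begin

text \<open>
  Every search tree is obtained from an ordering of the vertices by taking, in each connected
  piece, the first vertex as root. Swapping two consecutive vertices \<open>v\<close>, \<open>w\<close> of the ordering
  leaves the tree unchanged unless both lie in the same component of the graph induced on \<open>v\<close>,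
  \<open>w\<close> and all later vertices, and in that case it is a rotation. Fix an ordering of a search tree
  of minimum height and bubble-sort any other ordering into it, filling the positions from the
  front: bringing the next vertex \<open>y\<close> to its place costs at most as many rotations as the
  subtree of \<open>y\<close> in the fixed tree has vertices. Summed over all \<open>y\<close>, these subtree sizes count
  every vertex once per ancestor (itself included), hence are at most height times \<open>n\<close>. Going through the fixed
  tree gives the factor 2.
\<close>


section \<open>Elimination forests of vertex orderings\<close>

definition adjacent_to :: "('a \<Rightarrow> 'a \<Rightarrow> bool) \<Rightarrow> 'a \<Rightarrow> 'a set \<Rightarrow> bool" where
  "adjacent_to E x S \<longleftrightarrow> (\<exists>y\<in>S. E x y)"

text \<open>Vertices are inserted from the back of the list, so that earlier ones end up nearer the
  roots. Allowing forests keeps the induction on the list possible, since a suffix may induce a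
  disconnected graph.\<close>

primrec elim_forest :: "('a \<Rightarrow> 'a \<Rightarrow> bool) \<Rightarrow> 'a list \<Rightarrow> 'a rtree fset" where
  "elim_forest E [] = {||}"
| "elim_forest E (x # xs) =
     finsert (Node x (ffilter (\<lambda>T. adjacent_to E x (set_rtree T)) (elim_forest E xs)))
       (ffilter (\<lambda>T. \<not> adjacent_to E x (set_rtree T)) (elim_forest E xs))"

text \<open>If \<open>B\<close> holds the components on a vertex set without \<open>x\<close>, this
  is the component of \<open>x\<close> once \<open>x\<close> is added, which is also the tube of the
  subtree rooted at \<open>x\<close>.\<close>

definition top_block :: "('a \<Rightarrow> 'a \<Rightarrow> bool) \<Rightarrow> 'a \<Rightarrow> 'a set set \<Rightarrow> 'a set" where
  "top_block E x B = insert x (\<Union>{S \<in> B. adjacent_to E x S})"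

definition merge :: "('a \<Rightarrow> 'a \<Rightarrow> bool) \<Rightarrow> 'a \<Rightarrow> 'a set set \<Rightarrow> 'a set set" where
  "merge E x B = insert (top_block E x B) {S \<in> B. \<not> adjacent_to E x S}"

text \<open>
  The vertex sets of the components of the graph induced on \<open>set xs\<close>. Unlike the forest itself,
  they do not depend on the order of \<open>xs\<close>.
\<close>

definition blocks :: "('a \<Rightarrow> 'a \<Rightarrow> bool) \<Rightarrow> 'a list \<Rightarrow> 'a set set" where
  "blocks E xs = foldr (merge E) xs {}"

text \<open>Bounds the number of rotations that turn any search tree into that of \<open>xs\<close>.\<close>

primrec sort_cost :: "('a \<Rightarrow> 'a \<Rightarrow> bool) \<Rightarrow> 'a list \<Rightarrow> nat" where
  "sort_cost E [] = 0"
| "sort_cost E (x # xs) = card (top_block E x (blocks E xs)) + sort_cost E xs"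

definition forest_tubes :: "('a \<Rightarrow> 'a \<Rightarrow> bool) \<Rightarrow> 'a list \<Rightarrow> 'a set set" where
  "forest_tubes E xs = (\<Union>T\<in>fset (elim_forest E xs). tubes T)"

section \<open>Vertex sets and tubes of elimination forests\<close>

lemma blocks_simps [simp]:
  "blocks E [] = {}" "blocks E (x # xs) = merge E x (blocks E xs)"
  by (simp_all add: blocks_def)

lemma set_rtree_nonempty [simp]: "set_rtree T \<noteq> {}"
  by (cases T) auto

lemma blocks_elim_forest: "blocks E xs = set_rtree ` fset (elim_forest E xs)"
proof (induction xs)
  case (Cons x xs)
  then show ?case
    by (auto simp: merge_def top_block_def image_iff)
qed simp

lemma set_rtree_top:
  "set_rtree (Node x (ffilter (\<lambda>T. adjacent_to E x (set_rtree T)) (elim_forest E xs))) =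
   top_block E x (blocks E xs)"
  by (auto simp: top_block_def blocks_elim_forest)

lemma Union_blocks: "\<Union> (blocks E xs) = set xs"
  by (induction xs) (auto simp: merge_def top_block_def)

lemma set_rtree_elim_forest: "T |\<in>| elim_forest E xs \<Longrightarrow> set_rtree T \<subseteq> set xs"
  using Union_blocks[of E xs] by (auto simp: blocks_elim_forest)

lemma top_block_subset: "top_block E x (blocks E xs) \<subseteq> insert x (set xs)"
  using Union_blocks[of E xs] by (auto simp: top_block_def)

lemma finite_top_block [simp]: "finite (top_block E x (blocks E xs))"
  by (rule finite_subset[OF top_block_subset]) simp

lemma tubes_Node: "tubes (Node r ts) = insert (set_rtree (Node r ts)) (\<Union>T\<in>fset ts. tubes T)"
  by (auto simp: tubes_def)

text \<open>Trees that become children of the new root keep their tubes, so each inserted vertex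
  contributes one tube, its block, and removes none.\<close>

lemma forest_tubes_simps [simp]:
  "forest_tubes E [] = {}"
  "forest_tubes E (x # xs) = insert (top_block E x (blocks E xs)) (forest_tubes E xs)"
proof -
  have "forest_tubes E (x # xs) = insert (top_block E x (blocks E xs))
    ((\<Union>T\<in>{T. adjacent_to E x (set_rtree T)} \<inter> fset (elim_forest E xs). tubes T) \<union>
     (\<Union>T\<in>{T. \<not> adjacent_to E x (set_rtree T)} \<inter> fset (elim_forest E xs). tubes T))"
    by (simp add: forest_tubes_def tubes_Node set_rtree_top del: rtree.set)
  then show "forest_tubes E (x # xs) = insert (top_block E x (blocks E xs)) (forest_tubes E xs)"
    by (auto simp: forest_tubes_def)
qed (simp add: forest_tubes_def)

lemma forest_tubes_subset: "S \<in> forest_tubes E xs \<Longrightarrow> S \<subseteq> set xs"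
proof (induction xs)
  case (Cons x xs)
  then show ?case
    using top_block_subset[of E x xs] by auto
qed simp

text \<open>Vertices \<open>x\<close>, \<open>y\<close> not yet in \<open>B\<close> lie in the same component once both are merged into \<open>B\<close>.\<close>

definition linked :: "('a \<Rightarrow> 'a \<Rightarrow> bool) \<Rightarrow> 'a \<Rightarrow> 'a \<Rightarrow> 'a set set \<Rightarrow> bool" where
  "linked E x y B \<longleftrightarrow> E x y \<or> (\<exists>S\<in>B. adjacent_to E x S \<and> adjacent_to E y S)"

section \<open>Exchanging two consecutive vertices\<close>

lemma adjacent_to_insert [simp]: "adjacent_to E x (insert y S) \<longleftrightarrow> E x y \<or> adjacent_to E x S"
  by (auto simp: adjacent_to_def)

lemma adjacent_to_Union [simp]: "adjacent_to E x (\<Union>B) \<longleftrightarrow> (\<exists>S\<in>B. adjacent_to E x S)"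
  by (auto simp: adjacent_to_def)

lemma adjacent_top_block: "adjacent_to E x (top_block E y B) \<longleftrightarrow> linked E x y B"
  by (auto simp: top_block_def linked_def)

lemma linked_commute: "symp E \<Longrightarrow> linked E x y B \<longleftrightarrow> linked E y x B"
  by (auto simp: linked_def dest: sympD)

text \<open>If \<open>x\<close> and \<open>y\<close> are linked, \<open>x\<close> absorbs the whole
  block of \<open>y\<close>. Otherwise no member of \<open>B\<close> is adjacent to both, so
  everything adjacent to \<open>x\<close> survives the merging of \<open>y\<close>.\<close>

lemma top_block_merge:
  "top_block E x (merge E y B) =
   (if linked E x y B then top_block E x B \<union> top_block E y B else top_block E x B)"
proof -
  have *: "{S \<in> merge E y B. adjacent_to E x S} =
    (if linked E x y B then {top_block E y B} else {}) \<union> {S \<in> B. adjacent_to E x S \<and> \<not> adjacent_to E y S}"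
    by (auto simp: merge_def adjacent_top_block)
  have "\<not> linked E x y B \<Longrightarrow> {S \<in> B. adjacent_to E x S \<and> \<not> adjacent_to E y S} = {S \<in> B. adjacent_to E x S}"
    by (auto simp: linked_def)
  then show ?thesis
    unfolding top_block_def[of E x "merge E y B"] * by (auto simp: top_block_def)
qed

lemma merge_commute:
  assumes "symp E"
  shows "merge E x (merge E y B) = merge E y (merge E x B)"
proof -
  have *: "merge E x (merge E y B) =
     (if linked E x y B then {top_block E x B \<union> top_block E y B} else {top_block E x B, top_block E y B})
      \<union> {S \<in> B. \<not> adjacent_to E x S \<and> \<not> adjacent_to E y S}" for x y
    unfolding merge_def[of E x] top_block_merge by (auto simp: merge_def adjacent_top_block)
  show ?thesis
    unfolding * linked_commute[OF assms, of x y] by auto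
qed

lemma blocks_permute:
  assumes "symp E" "mset xs = mset ys"
  shows "blocks E xs = blocks E ys"
proof -
  have "fold (merge E) (rev xs) = fold (merge E) (rev ys)"
    by (rule fold_multiset_equiv) (use assms in \<open>auto simp: fun_eq_iff merge_commute\<close>)
  then show ?thesis
    by (simp add: blocks_def foldr_conv_fold)
qed

lemma blocks_append_cong: "blocks E zs = blocks E zs' \<Longrightarrow> blocks E (ps @ zs) = blocks E (ps @ zs')"
  by (simp add: blocks_def)

text \<open>A prefix sees its suffix only through the blocks, so over both suffixes it adds the same
  tubes \<open>P\<close>. Each of them contains the prefix vertex that created it, which tells it
  apart from subsets of the suffix.\<close>

lemma forest_tubes_append:
  assumes "blocks E zs = blocks E zs'"
  obtains P where "forest_tubes E (ps @ zs) = P \<union> forest_tubes E zs"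
    "forest_tubes E (ps @ zs') = P \<union> forest_tubes E zs'" "\<forall>S\<in>P. S \<inter> set ps \<noteq> {}"
proof -
  have "\<exists>P. forest_tubes E (ps @ zs) = P \<union> forest_tubes E zs \<and>
    forest_tubes E (ps @ zs') = P \<union> forest_tubes E zs' \<and> (\<forall>S\<in>P. S \<inter> set ps \<noteq> {})"
  proof (induction ps)
    case (Cons p ps)
    then obtain P where P: "forest_tubes E (ps @ zs) = P \<union> forest_tubes E zs"
      "forest_tubes E (ps @ zs') = P \<union> forest_tubes E zs'" "\<forall>S\<in>P. S \<inter> set ps \<noteq> {}"
      by blast
    show ?case
      by (rule exI[of _ "insert (top_block E p (blocks E (ps @ zs))) P"])
        (use P in \<open>auto simp: top_block_def blocks_append_cong[OF assms]\<close>)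
  qed simp
  then show ?thesis
    using that by blast
qed

text \<open>Unlinked vertices absorb disjoint collections of trees, and neither is adjacent to the
  tree of the other, so the order of insertion is irrelevant.\<close>

lemma elim_forest_swap:
  assumes "\<not> linked E v w (blocks E qs)" "symp E"
  shows "elim_forest E (v # w # qs) = elim_forest E (w # v # qs)"
proof -
  have *: "\<not> linked E w v (blocks E qs)"
    using assms linked_commute by metis
  have 1: "ffilter (\<lambda>T. adjacent_to E v (set_rtree T)) (elim_forest E (w # qs)) =
    ffilter (\<lambda>T. adjacent_to E v (set_rtree T)) (elim_forest E qs)" if "\<not> linked E v w (blocks E qs)" for v w
    using that unfolding elim_forest.simps
    by (auto simp: fset_eq_iff set_rtree_top adjacent_top_block simp del: rtree.set)
      (auto simp: linked_def blocks_elim_forest)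
  show ?thesis
    unfolding elim_forest.simps(2)[of E _ "_ # _"] 1[OF *] 1[OF assms(1)]
    using * assms(1)
    by (auto simp: fset_eq_iff set_rtree_top adjacent_top_block linked_def blocks_elim_forest
        simp del: rtree.set)
qed

lemma elim_forest_append_cong:
  "elim_forest E zs = elim_forest E zs' \<Longrightarrow> elim_forest E (ps @ zs) = elim_forest E (ps @ zs')"
  by (induction ps) auto

text \<open>In both orders the vertex inserted last gets the common tube
  \<open>?V \<union> ?W\<close>, while the one inserted first keeps its own block. Only
  \<open>?W\<close> is replaced by \<open>?V\<close>.\<close>

lemma forest_tubes_swap:
  assumes "symp E" "distinct (ps @ v # w # qs)" "linked E v w (blocks E qs)"
  defines "A \<equiv> forest_tubes E (ps @ v # w # qs)" and "B \<equiv> forest_tubes E (ps @ w # v # qs)"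
  shows "card ((A - B) \<union> (B - A)) = 2"
proof -
  let ?V = "top_block E v (blocks E qs)" and ?W = "top_block E w (blocks E qs)"
  have "blocks E (v # w # qs) = blocks E (w # v # qs)"
    by (simp add: merge_commute[OF assms(1), of v w])
  then obtain P where P: "A = P \<union> forest_tubes E (v # w # qs)" "B = P \<union> forest_tubes E (w # v # qs)"
    "\<forall>S\<in>P. S \<inter> set ps \<noteq> {}"
    unfolding A_def B_def by (rule forest_tubes_append[where ps = ps])
  have link: "linked E w v (blocks E qs)"
    using assms linked_commute by metis
  have VW: "v \<in> ?V" "w \<in> ?W" "?V \<subseteq> insert v (set qs)" "?W \<subseteq> insert w (set qs)"
    by (simp_all add: top_block_subset) (simp_all add: top_block_def)
  have Q: "S \<subseteq> set qs" if "S \<in> forest_tubes E qs" for S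
    using that by (rule forest_tubes_subset)
  \<comment> \<open>Members of \<open>P\<close> meet \<open>ps\<close>, which is disjoint from
    \<open>v\<close>, \<open>w\<close> and \<open>qs\<close>.\<close>
  have "?V \<notin> P" "?W \<notin> P"
    using VW P(3) assms(2) by (auto dest!: bspec)
  then have "(A - B) \<union> (B - A) = {?V, ?W}"
    unfolding P(1,2) using Q VW assms(2,3) link
    by (auto simp: top_block_merge)
  moreover have "?V \<noteq> ?W"
    using VW assms(2) by auto
  ultimately show ?thesis
    by simp
qed

section \<open>Separated vertex sets and concatenation of orderings\<close>

definition separated :: "('a \<Rightarrow> 'a \<Rightarrow> bool) \<Rightarrow> 'a set \<Rightarrow> 'a set \<Rightarrow> bool" where
  "separated E S T \<longleftrightarrow> S \<inter> T = {} \<and> (\<forall>x\<in>S. \<not> adjacent_to E x T)"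

lemma separated_commute: "symp E \<Longrightarrow> separated E S T \<longleftrightarrow> separated E T S"
  by (auto simp: separated_def adjacent_to_def dest: sympD)

text \<open>The new tree is separated from an unabsorbed one: at its root by the filter and
  distinctness, elsewhere by induction on the absorbed trees.\<close>

lemma elim_forest_separated:
  assumes "symp E" "distinct xs"
  shows "\<lbrakk>S |\<in>| elim_forest E xs; T |\<in>| elim_forest E xs; S \<noteq> T\<rbrakk>
    \<Longrightarrow> separated E (set_rtree S) (set_rtree T)"
  using assms(2)
proof (induction xs arbitrary: S T)
  case (Cons x xs)
  let ?N = "Node x (ffilter (\<lambda>T. adjacent_to E x (set_rtree T)) (elim_forest E xs))"
  have IH: "separated E (set_rtree S) (set_rtree T)"
    if "S |\<in>| elim_forest E xs" "T |\<in>| elim_forest E xs" "S \<noteq> T" for S T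
    using Cons that by simp
  have new: "separated E (set_rtree ?N) (set_rtree T)"
    if "T |\<in>| elim_forest E xs" "\<not> adjacent_to E x (set_rtree T)" for T
  proof -
    have "x \<notin> set_rtree T"
      using set_rtree_elim_forest[OF that(1)] Cons.prems by auto
    moreover have "separated E (set_rtree S) (set_rtree T)"
      if "S |\<in>| elim_forest E xs" "adjacent_to E x (set_rtree S)" for S
      using IH that \<open>T |\<in>| _\<close> \<open>\<not> adjacent_to E x (set_rtree T)\<close> by blast
    ultimately show ?thesis
      using that(2) by (auto simp: separated_def)
  qed
  consider "S = ?N" "T |\<in>| elim_forest E xs" "\<not> adjacent_to E x (set_rtree T)"
    | "T = ?N" "S |\<in>| elim_forest E xs" "\<not> adjacent_to E x (set_rtree S)"
    | "S |\<in>| elim_forest E xs" "T |\<in>| elim_forest E xs"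
    using Cons.prems(1-3) by auto
  then show ?case
    using new IH Cons.prems(3) separated_commute[OF assms(1)] by cases metis+
qed simp

text \<open>Lets a tree of the forest be recovered from its vertex set, as distinct trees have
  disjoint nonempty vertex sets.\<close>

lemma inj_on_set_rtree_elim_forest:
  "symp E \<Longrightarrow> distinct xs \<Longrightarrow> inj_on set_rtree (fset (elim_forest E xs))"
  by (rule inj_onI) (metis elim_forest_separated inf.idem separated_def set_rtree_nonempty)

lemma blocks_separated:
  "\<lbrakk>symp E; distinct xs; S \<in> blocks E xs; T \<in> blocks E xs; S \<noteq> T\<rbrakk> \<Longrightarrow> separated E S T"
  by (auto simp: blocks_elim_forest intro: elim_forest_separated)

text \<open>No vertex of \<open>xs\<close> is adjacent to a tree over \<open>ys\<close>, so the
  trees over \<open>ys\<close> are never absorbed.\<close>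

lemma elim_forest_append:
  assumes "separated E (set xs) (set ys)"
  shows "elim_forest E (xs @ ys) = elim_forest E xs |\<union>| elim_forest E ys"
  using assms
proof (induction xs)
  case (Cons x xs)
  then have IH: "elim_forest E (xs @ ys) = elim_forest E xs |\<union>| elim_forest E ys"
    by (simp add: separated_def)
  have "\<not> adjacent_to E x (set_rtree T)" if "T |\<in>| elim_forest E ys" for T
    using Cons.prems set_rtree_elim_forest[OF that] by (auto simp: separated_def adjacent_to_def)
  then have "ffilter (\<lambda>T. adjacent_to E x (set_rtree T)) (elim_forest E ys) = {||}"
    "ffilter (\<lambda>T. \<not> adjacent_to E x (set_rtree T)) (elim_forest E ys) = elim_forest E ys"
    by (auto simp: fset_eq_iff)
  then show ?case
    by (auto simp: IH fset_eq_iff simp del: rtree.set)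
qed simp

lemma tree_height_child: "T |\<in>| ts \<Longrightarrow> Suc (tree_height T) \<le> tree_height (Node r ts)"
  by simp

text \<open>If the new tree has height \<open>h + 1\<close> and size \<open>s\<close>, the absorbed
  trees have height at most \<open>h\<close> and total size at most \<open>s\<close>, hence weight
  at most \<open>h * s\<close>. The cost \<open>s\<close> of the new vertex fills the gap to
  \<open>(h + 1) * s\<close>.\<close>

lemma sort_cost_le:
  assumes "symp E" "distinct xs"
  shows "sort_cost E xs \<le> (\<Sum>T\<in>fset (elim_forest E xs). tree_height T * card (set_rtree T))"
  using assms(2)
proof (induction xs)
  case (Cons x xs)
  define F where "F = elim_forest E xs"
  define A where "A = ffilter (\<lambda>T. adjacent_to E x (set_rtree T)) F"
  define B where "B = ffilter (\<lambda>T. \<not> adjacent_to E x (set_rtree T)) F"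
  let ?w = "\<lambda>T. tree_height T * card (set_rtree T)"
  have F: "fset F = fset A \<union> fset B" "fset A \<inter> fset B = {}"
    by (auto simp: A_def B_def)
  have sub: "set_rtree T \<subseteq> set xs" if "T |\<in>| F" for T
    using that by (auto simp: F_def dest: set_rtree_elim_forest)
  have top: "set_rtree (Node x A) = top_block E x (blocks E xs)"
    unfolding A_def F_def by (rule set_rtree_top)
  \<comment> \<open>Needed to split the new tree off the sum over the forest, where a duplicate
    would count once.\<close>
  have "Node x A \<notin> fset B"
    using sub Cons.prems by (force simp: B_def)
  have "card (\<Union>T\<in>fset A. set_rtree T) = (\<Sum>T\<in>fset A. card (set_rtree T))"
    using elim_forest_separated[OF assms(1), of xs] Cons.prems
    by (intro card_UN_disjoint)
      (auto simp: A_def F_def separated_def intro: finite_subset[OF set_rtree_elim_forest])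
  moreover have "(\<Union>T\<in>fset A. set_rtree T) \<subseteq> set_rtree (Node x A)"
    by auto
  then have "card (\<Union>T\<in>fset A. set_rtree T) \<le> card (set_rtree (Node x A))"
    unfolding top by (intro card_mono) auto
  ultimately have card: "(\<Sum>T\<in>fset A. card (set_rtree T)) \<le> card (set_rtree (Node x A))"
    by simp
  obtain h where h: "tree_height (Node x A) = Suc h"
    by simp
  have "(\<Sum>T\<in>fset A. ?w T) \<le> (\<Sum>T\<in>fset A. h * card (set_rtree T))"
    by (intro sum_mono mult_right_mono) (use tree_height_child[of _ A x] h in auto)
  also have "\<dots> \<le> h * card (set_rtree (Node x A))"
    using card by (simp flip: sum_distrib_left)
  finally have A: "(\<Sum>T\<in>fset A. ?w T) + card (set_rtree (Node x A)) \<le> ?w (Node x A)"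
    unfolding h by simp
  have "sort_cost E (x # xs) \<le> card (set_rtree (Node x A)) + (\<Sum>T\<in>fset F. ?w T)"
    using Cons by (simp add: top F_def del: rtree.set)
  also have "\<dots> = card (set_rtree (Node x A)) + (\<Sum>T\<in>fset A. ?w T) + (\<Sum>T\<in>fset B. ?w T)"
    unfolding F(1) using F(2) by (simp add: sum.union_disjoint del: rtree.set)
  also have "\<dots> \<le> ?w (Node x A) + (\<Sum>T\<in>fset B. ?w T)"
    using A by linarith
  also have "\<dots> = (\<Sum>T\<in>fset (elim_forest E (x # xs)). ?w T)"
    using \<open>Node x A \<notin> fset B\<close> unfolding elim_forest.simps F_def[symmetric] A_def[symmetric] B_def[symmetric]
    by (simp del: rtree.set)
  finally show ?case .
qed simp

section \<open>Search trees as elimination trees\<close>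

text \<open>A walk cannot leave a closed set, and the set reachable from a vertex is closed.
  Connectivity arguments about subgraphs can then use sets in place of walks.\<close>

lemma connected_iff_closed:
  "Digraph_Component.connected H \<longleftrightarrow> verts H \<noteq> {} \<and>
    (\<forall>A \<subseteq> verts H. A \<noteq> {} \<longrightarrow> (\<forall>x\<in>A. \<forall>y\<in>verts H. (x, y) \<in> (arcs_ends H)\<^sup>s \<longrightarrow> y \<in> A) \<longrightarrow> A = verts H)"
    (is "_ \<longleftrightarrow> _ \<and> ?closed")
proof
  assume conn: "Digraph_Component.connected H"
  have "y \<in> A" if A: "A \<subseteq> verts H" "\<forall>x\<in>A. \<forall>y\<in>verts H. (x, y) \<in> (arcs_ends H)\<^sup>s \<longrightarrow> y \<in> A"
    "x \<in> A" "y \<in> verts H" for A x y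
  proof -
    have "(x, y) \<in> rtrancl_on (verts H) ((arcs_ends H)\<^sup>s)"
      using conn that unfolding connected_conv by blast
    then show ?thesis
      by (induct rule: rtrancl_on_induct) (use A in auto)
  qed
  then show "verts H \<noteq> {} \<and> ?closed"
    using conn unfolding connected_conv by blast
next
  assume H: "verts H \<noteq> {} \<and> ?closed"
  have "(x, y) \<in> rtrancl_on (verts H) ((arcs_ends H)\<^sup>s)" if "x \<in> verts H" "y \<in> verts H" for x y
  proof -
    let ?A = "{z. (x, z) \<in> rtrancl_on (verts H) ((arcs_ends H)\<^sup>s)}"
    have "?A \<subseteq> verts H" "?A \<noteq> {}"
      using that by (auto dest: in_rtrancl_on_in_F)
    then have "?A = verts H"
      using H by (auto intro: rtrancl_on_into_rtrancl_on)
    then show ?thesis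
      using that by auto
  qed
  then show "Digraph_Component.connected H"
    using H by (simp add: connected_conv)
qed

lemma search_tree_connected: "search_tree H T \<Longrightarrow> Digraph_Component.connected H"
  by (erule search_tree.cases) simp

lemma subgraph_induce_iff:
  assumes "wf_digraph G" "U \<subseteq> verts G"
  shows "subgraph C (G \<restriction> U) \<longleftrightarrow> subgraph C G \<and> verts C \<subseteq> U"
  using assms
  by (auto simp: subgraph_def compatible_def wf_digraph.wellformed_induce_subgraph)
    (metis wf_digraph.tail_in_verts wf_digraph.head_in_verts subsetD)+

context sym_digraph
begin

abbreviation adj :: "'a \<Rightarrow> 'a \<Rightarrow> bool" where
  "adj u v \<equiv> u \<rightarrow> v"

lemma symp_adj: "symp adj"
  by (auto intro: sympI graph_symmetric)

lemma connected_induce_iff: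
  "Digraph_Component.connected (G \<restriction> S) \<longleftrightarrow> S \<noteq> {} \<and>
    (\<forall>A \<subseteq> S. A \<noteq> {} \<longrightarrow> (\<forall>x\<in>A. \<forall>y\<in>S. adj x y \<longrightarrow> y \<in> A) \<longrightarrow> A = S)"
proof -
  have "(x, y) \<in> (arcs_ends (G \<restriction> S))\<^sup>s \<longleftrightarrow> adj x y" if "x \<in> S" "y \<in> S" for x y
  proof
    assume "(x, y) \<in> (arcs_ends (G \<restriction> S))\<^sup>s"
    then show "adj x y"
      by (auto simp: symcl_def intro: dominates_induce_subgraphD graph_symmetric)
  next
    assume "adj x y"
    then show "(x, y) \<in> (arcs_ends (G \<restriction> S))\<^sup>s"
      using that by (auto simp: symcl_def arcs_ends_conv)
  qed
  then show ?thesis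
    unfolding connected_iff_closed induce_subgraph_verts
    by (intro arg_cong2[of _ _ _ _ "(\<and>)"] refl all_cong) blast
qed

text \<open>An edge of \<open>C\<close> starting in \<open>S\<close> ends in some member of
  \<open>P\<close>, which is \<open>S\<close> because distinct members are not joined by edges. So
  the part of \<open>C\<close> in \<open>S\<close> is closed.\<close>

lemma connected_subgraph_subset:
  assumes "subgraph C G" "Digraph_Component.connected C" "verts C \<subseteq> \<Union>P"
    and P: "\<And>S T. S \<in> P \<Longrightarrow> T \<in> P \<Longrightarrow> S \<noteq> T \<Longrightarrow> separated adj S T"
    and S: "S \<in> P" "verts C \<inter> S \<noteq> {}"
  shows "verts C \<subseteq> S"
proof -
  have adj: "adj x y" if "(x, y) \<in> (arcs_ends C)\<^sup>s" for x y
    using that arcs_ends_mono[OF assms(1)] by (auto simp: symcl_def intro: graph_symmetric)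
  have "y \<in> S" if xy: "x \<in> S" "y \<in> verts C" "(x, y) \<in> (arcs_ends C)\<^sup>s" for x y
  proof -
    obtain T where T: "T \<in> P" "y \<in> T"
      using \<open>y \<in> verts C\<close> assms(3) by blast
    then have "S = T"
      using P[OF S(1) T(1)] adj[OF xy(3)] xy(1) by (auto simp: separated_def adjacent_to_def)
    then show ?thesis
      using T by simp
  qed
  then have "verts C \<inter> S = verts C"
    using assms(2) S(2) unfolding connected_iff_closed by blast
  then show ?thesis
    by blast
qed

text \<open>Components are maximal connected subgraphs, in arcs as well as vertices. A connected
  subgraph stays inside one member of \<open>P\<close>, so maximality makes it the whole subgraph
  induced there.\<close>

lemma components_partition:
  assumes U: "U \<subseteq> verts G" "\<Union>P = U"
    and conn: "\<And>S. S \<in> P \<Longrightarrow> Digraph_Component.connected (G \<restriction> S)"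
    and sep: "\<And>S T. S \<in> P \<Longrightarrow> T \<in> P \<Longrightarrow> S \<noteq> T \<Longrightarrow> separated adj S T"
  shows "components (G \<restriction> U) = (\<restriction>) G ` P"
proof -
  have sub: "subgraph C (G \<restriction> S) \<longleftrightarrow> subgraph C G \<and> verts C \<subseteq> S" if "S \<subseteq> U" for S C
    using subgraph_induce_iff[OF wf_digraph, of S] that U by blast
  have ind: "subgraph (G \<restriction> S) G" if "S \<subseteq> U" for S
    using that U by (intro subgraph_induce_subgraphI) auto
  have "C \<in> (\<restriction>) G ` P" if "C \<in> components (G \<restriction> U)" for C
  proof -
    have C: "subgraph C (G \<restriction> U)" "Digraph_Component.connected C"
      "\<And>H. H \<noteq> C \<Longrightarrow> subgraph C H \<Longrightarrow> subgraph H (G \<restriction> U) \<Longrightarrow> \<not> Digraph_Component.connected H"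
      using that by (auto simp: components_def pre_digraph.max_subgraph_def)
    have C': "subgraph C G" "verts C \<subseteq> U"
      using C(1) sub by auto
    obtain x where "x \<in> verts C"
      using C(2) by (auto simp: connected_conv)
    moreover from this obtain S where "x \<in> S" "S \<in> P"
      using C' U(2) by blast
    ultimately have "verts C \<subseteq> S"
      using connected_subgraph_subset[OF C'(1) C(2) _ sep] C'(2) U(2) by blast
    then have "subgraph C (G \<restriction> S)" "subgraph (G \<restriction> S) (G \<restriction> U)"
      using \<open>S \<in> P\<close> U(2) C' ind by (auto simp: sub Sup_upper)
    then have "C = G \<restriction> S"
      using C(3)[of "G \<restriction> S"] conn[OF \<open>S \<in> P\<close>] by blast
    then show ?thesis
      using \<open>S \<in> P\<close> by blast
  qed
  moreover have "G \<restriction> S \<in> components (G \<restriction> U)" if "S \<in> P" for S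
  proof -
    have "S \<subseteq> U"
      using that U by auto
    have "H = G \<restriction> S" if H: "subgraph (G \<restriction> S) H" "subgraph H (G \<restriction> U)" "Digraph_Component.connected H" for H
    proof -
      have HG: "subgraph H G" "verts H \<subseteq> U"
        using H(2) sub by auto
      have "S \<subseteq> verts H" "S \<noteq> {}"
        using H(1) conn[OF \<open>S \<in> P\<close>] by (auto simp: connected_conv subgraph_def)
      then have "verts H \<subseteq> S"
        using connected_subgraph_subset[OF HG(1) H(3) _ sep \<open>S \<in> P\<close>] HG(2) U(2) by blast
      then have "subgraph H (G \<restriction> S)"
        using HG \<open>S \<subseteq> U\<close> by (simp add: sub)
      then show ?thesis
        \<comment> \<open>Mutual subgraphs agree in vertices and arcs, and compatibility gives equal
          tail and head maps.\<close>
        using H(1) unfolding subgraph_def compatible_def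
        by (intro pre_digraph.equality) auto
    qed
    then show ?thesis
      using conn[OF that] ind \<open>S \<subseteq> U\<close>
      unfolding components_def pre_digraph.max_subgraph_def by (auto simp: sub)
  qed
  ultimately show ?thesis
    by blast
qed

section \<open>From elimination forests to search trees\<close>

lemma del_vert_induce: "pre_digraph.del_vert (G \<restriction> S) x = G \<restriction> (S - {x})"
  by (auto simp: pre_digraph.del_vert_def induce_subgraph_def)

text \<open>A closed set \<open>A\<close> contains every adjacent block that it meets, hence a
  neighbour of \<open>x\<close> and then \<open>x\<close> itself. From \<open>x\<close> it enters
  all the other adjacent blocks.\<close>

lemma connected_top_block:
  assumes "\<And>S. S \<in> B \<Longrightarrow> Digraph_Component.connected (G \<restriction> S)"
  shows "Digraph_Component.connected (G \<restriction> top_block adj x B)"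
  unfolding connected_induce_iff
proof (intro conjI allI impI)
  fix A
  assume A: "A \<subseteq> top_block adj x B" "A \<noteq> {}" "\<forall>u\<in>A. \<forall>v\<in>top_block adj x B. adj u v \<longrightarrow> v \<in> A"
  have full: "S \<subseteq> A" if S: "S \<in> B" "adjacent_to adj x S" "A \<inter> S \<noteq> {}" for S
  proof -
    have "S \<subseteq> top_block adj x B"
      using S by (auto simp: top_block_def)
    then have "\<forall>u\<in>A \<inter> S. \<forall>v\<in>S. adj u v \<longrightarrow> v \<in> A \<inter> S"
      using A(3) by auto
    then have "A \<inter> S = S"
      using assms[OF S(1)] S(3) unfolding connected_induce_iff by blast
    then show ?thesis
      by blast
  qed
  have "x \<in> A"
  proof (rule ccontr)
    assume "x \<notin> A"
    then obtain S where S: "S \<in> B" "adjacent_to adj x S" "A \<inter> S \<noteq> {}"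
      using A(1,2) by (auto simp: top_block_def)
    then obtain y where "y \<in> A" "adj y x"
      using full by (auto simp: adjacent_to_def intro: graph_symmetric)
    then show False
      using A(3) \<open>x \<notin> A\<close> by (auto simp: top_block_def)
  qed
  have "S \<subseteq> A" if S: "S \<in> B" "adjacent_to adj x S" for S
  proof -
    obtain y where "y \<in> S" "adj x y"
      using S by (auto simp: adjacent_to_def)
    moreover have "y \<in> top_block adj x B"
      using S \<open>y \<in> S\<close> by (auto simp: top_block_def)
    ultimately have "y \<in> A"
      using A(3) \<open>x \<in> A\<close> by blast
    then show ?thesis
      using full[OF S] \<open>y \<in> S\<close> by blast
  qed
  then show "A = top_block adj x B"
    using A(1) \<open>x \<in> A\<close> by (auto simp: top_block_def)
qed (simp add: top_block_def)

lemma search_tree_elim_forest: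
  assumes "distinct xs" "set xs \<subseteq> verts G" "T |\<in>| elim_forest adj xs"
  shows "search_tree (G \<restriction> set_rtree T) T"
  using assms
proof (induction xs arbitrary: T)
  case (Cons x xs)
  define F where "F = ffilter (\<lambda>T. adjacent_to adj x (set_rtree T)) (elim_forest adj xs)"
  have IH: "search_tree (G \<restriction> set_rtree T) T" if "T |\<in>| elim_forest adj xs" for T
    using Cons that by simp
  show ?case
  proof (cases "T |\<in>| elim_forest adj xs")
    case False
    then have T: "T = Node x F"
      using Cons.prems(3) by (auto simp: F_def)
    have top: "set_rtree T = top_block adj x (blocks adj xs)"
      unfolding T F_def by (rule set_rtree_top)
    have conn: "Digraph_Component.connected (G \<restriction> S)" if "S \<in> blocks adj xs" for S
      using that IH search_tree_connected by (auto simp: blocks_elim_forest)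
    have FS: "fset F \<subseteq> fset (elim_forest adj xs)"
      by (auto simp: F_def)
    have "x \<notin> \<Union> (set_rtree ` fset F)"
      using FS set_rtree_elim_forest[of _ adj xs] Cons.prems(1) by fastforce
    then have rest: "set_rtree T - {x} = \<Union> (set_rtree ` fset F)"
      by (auto simp: T)
    have comps: "components (G \<restriction> (set_rtree T - {x})) = (\<restriction>) G ` (set_rtree ` fset F)"
    proof (intro components_partition)
      show "set_rtree T - {x} \<subseteq> verts G"
        using set_rtree_elim_forest[OF Cons.prems(3)] Cons.prems(2) by auto
      show "separated adj S S'" if "S \<in> set_rtree ` fset F" "S' \<in> set_rtree ` fset F" "S \<noteq> S'" for S S'
        using that FS blocks_separated[OF symp_adj, of xs S S'] Cons.prems(1)
        by (auto simp: blocks_elim_forest)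
    qed (use rest conn FS in \<open>auto simp: blocks_elim_forest\<close>)
    \<comment> \<open>The rule for search trees chooses a subtree for each component; here it is the
      one spanning the vertices of the component.\<close>
    define t where "t C = inv_into (fset F) set_rtree (verts C)" for C :: "('a, 'b) pre_digraph"
    have inj: "inj_on set_rtree (fset F)"
      using inj_on_set_rtree_elim_forest[OF symp_adj, of xs] Cons.prems(1) FS
      by (auto intro: inj_on_subset)
    have t: "t (G \<restriction> set_rtree S) = S" if "S |\<in>| F" for S
      using that inj by (simp add: t_def)
    show ?thesis
      unfolding T
    proof (rule search_tree.intros[where t = t], goal_cases)
      case 1
      show ?case
        unfolding T[symmetric] top using conn by (rule connected_top_block)
    next
      case 3
      show ?case
        unfolding T[symmetric] del_vert_induce comps using t IH FS by auto
    next
      case 4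
      show ?case
        unfolding T[symmetric] del_vert_induce comps using t by (force simp: image_iff)
    qed simp
  qed (rule IH)
qed simp

lemma connected_blocks:
  assumes "distinct xs" "set xs \<subseteq> verts G" "S \<in> blocks adj xs"
  shows "Digraph_Component.connected (G \<restriction> S)"
  using assms search_tree_elim_forest search_tree_connected unfolding blocks_elim_forest by blast

lemma components_blocks:
  assumes "distinct xs" "set xs \<subseteq> verts G"
  shows "components (G \<restriction> set xs) = (\<restriction>) G ` blocks adj xs"
  using assms
  by (intro components_partition connected_blocks blocks_separated symp_adj Union_blocks) auto

lemma induce_verts [simp]: "G \<restriction> verts G = G"
  by (rule pre_digraph.equality) auto

end

text \<open>Meaningful only if \<open>set xs\<close> induces a connected graph, so that the forest is a single tree.\<close>

definition elim_tree :: "('a \<Rightarrow> 'a \<Rightarrow> bool) \<Rightarrow> 'a list \<Rightarrow> 'a rtree" where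
  "elim_tree E xs = (THE T. elim_forest E xs = {|T|})"

lemma elim_tree_eqI: "elim_forest E xs = {|T|} \<Longrightarrow> elim_tree E xs = T"
  by (auto simp: elim_tree_def)

lemma forest_tubes_singleton: "elim_forest E xs = {|T|} \<Longrightarrow> forest_tubes E xs = tubes T"
  by (simp add: forest_tubes_def)

text \<open>Orderings of pairwise separated pieces are concatenated one piece at a time;
  \<open>f\<close> names the tree of each piece.\<close>

lemma elim_forest_combine:
  assumes "symp E" "finite P"
    and "\<And>S T. S \<in> P \<Longrightarrow> T \<in> P \<Longrightarrow> S \<noteq> T \<Longrightarrow> separated E S T"
    and "\<And>S. S \<in> P \<Longrightarrow> \<exists>xs. distinct xs \<and> set xs = S \<and> elim_forest E xs = {|f S|}"
  obtains xs where "distinct xs" "set xs = \<Union>P" "fset (elim_forest E xs) = f ` P"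
proof -
  have "\<exists>xs. distinct xs \<and> set xs = \<Union>P \<and> fset (elim_forest E xs) = f ` P"
    using assms(2-)
  proof (induction P rule: finite_induct)
    case (insert S P)
    then obtain ys where ys: "distinct ys" "set ys = \<Union>P" "fset (elim_forest E ys) = f ` P"
      by auto
    obtain xs where xs: "distinct xs" "set xs = S" "elim_forest E xs = {|f S|}"
      using insert.prems(2)[of S] by auto
    have "separated E S T" if "T \<in> P" for T
      using insert.prems(1)[of S T] insert.hyps that by auto
    then have "separated E (set xs) (set ys)"
      unfolding xs ys by (auto simp: separated_def)
    then have "elim_forest E (xs @ ys) = elim_forest E xs |\<union>| elim_forest E ys" "set xs \<inter> set ys = {}"
      by (auto simp: elim_forest_append separated_def)
    then show ?case
      using xs ys by (intro exI[of _ "xs @ ys"]) auto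
  qed simp
  then show ?thesis
    using that by blast
qed

text \<open>An upper bound on the number of steps suits sorting, where some swaps leave the tree
  unchanged.\<close>

definition reach_within :: "'a rel \<Rightarrow> nat \<Rightarrow> 'a \<Rightarrow> 'a \<Rightarrow> bool" where
  "reach_within R k x y \<longleftrightarrow> (\<exists>m\<le>k. (x, y) \<in> R ^^ m)"

lemma reach_within_refl [simp]: "reach_within R k x x"
  by (auto simp: reach_within_def intro: exI[of _ 0])

lemma reach_within_step: "(x, y) \<in> R \<Longrightarrow> reach_within R 1 x y"
  by (auto simp: reach_within_def intro!: exI[of _ 1])

lemma reach_within_mono: "reach_within R k x y \<Longrightarrow> k \<le> l \<Longrightarrow> reach_within R l x y"
  unfolding reach_within_def by (meson order_trans)

lemma reach_within_trans: "reach_within R k x y \<Longrightarrow> reach_within R l y z \<Longrightarrow> reach_within R (k + l) x z"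
  unfolding reach_within_def by (metis add_mono relcompI relpow_add)

lemma reach_within_sym:
  assumes "sym R" "reach_within R k x y"
  shows "reach_within R k y x"
proof -
  have "(y, x) \<in> R ^^ m" if "(x, y) \<in> R ^^ m" for m
    using that by (induction m arbitrary: y) (simp, metis assms(1) relpow_Suc_E relpow_Suc_I2 symD)
  then show ?thesis
    using assms(2) by (auto simp: reach_within_def)
qed

section \<open>From relation powers to walks and distances\<close>

lemma awalk_of_relpow:
  assumes "wf_digraph G" "u \<in> verts G" "(u, v) \<in> arcs_ends G ^^ m"
  shows "\<exists>p. pre_digraph.awalk G u p v \<and> length p = m"
proof -
  interpret wf_digraph G by fact
  show ?thesis
    using assms(3)
  proof (induction m arbitrary: v)
    case 0
    then show ?case
      using assms(2) by (intro exI[of _ "[]"]) (simp add: awalk_Nil_iff)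
  next
    case (Suc m)
    then obtain w where "(u, w) \<in> arcs_ends G ^^ m" "(w, v) \<in> arcs_ends G"
      by auto
    then obtain p a where "awalk u p w" "length p = m" "a \<in> arcs G" "tail G a = w" "head G a = v"
      using Suc.IH by (fastforce simp: arcs_ends_def arc_to_ends_def)
    then show ?case
      by (intro exI[of _ "p @ [a]"]) (auto intro!: awalk_appendI simp: awalk_simps)
  qed
qed

lemma distance_le:
  assumes "wf_digraph G" "u \<in> verts G" "reach_within (arcs_ends G) k u v"
  shows "wf_digraph.\<mu> G (\<lambda>_. 1) u v \<le> ereal (real k)"
proof -
  interpret wf_digraph G by fact
  obtain m where "m \<le> k" "(u, v) \<in> arcs_ends G ^^ m"
    using assms(3) by (auto simp: reach_within_def)
  then obtain p where p: "awalk u p v" "length p = m"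
    using awalk_of_relpow[OF assms(1,2)] by blast
  have "awalk_cost (\<lambda>_. 1) p = real m"
    using p(2) by (simp add: awalk_cost_def sum_list_triv)
  then show ?thesis
    using min_cost_le_walk_cost[OF p(1), of "\<lambda>_. 1"] \<open>m \<le> k\<close>
    by (metis ereal_less_eq(3) of_nat_le_iff order_trans)
qed

section \<open>Orderings of search trees, and sorting them by rotations\<close>

context sym_digraph
begin

text \<open>Each tree spans a piece separated from the others, which in a connected graph must be
  everything. Distinct trees have distinct vertex sets, so only one exists.\<close>

lemma elim_forest_connected:
  assumes "Digraph_Component.connected G" "distinct xs" "set xs = verts G"
  obtains T where "elim_forest adj xs = {|T|}" "search_tree G T"
proof -
  let ?F = "elim_forest adj xs"
  have whole: "set_rtree T = verts G" if "T |\<in>| ?F" for T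
  proof -
    have "verts G \<subseteq> set_rtree T"
    proof (rule connected_subgraph_subset[OF subgraph_refl assms(1)])
      show "verts G \<subseteq> \<Union> (blocks adj xs)"
        using assms by (simp add: Union_blocks)
      show "separated adj S S'" if "S \<in> blocks adj xs" "S' \<in> blocks adj xs" "S \<noteq> S'" for S S'
        using blocks_separated[OF symp_adj assms(2)] that .
      show "set_rtree T \<in> blocks adj xs"
        using that by (simp add: blocks_elim_forest)
      show "verts G \<inter> set_rtree T \<noteq> {}"
        using set_rtree_elim_forest[OF that] assms(3) set_rtree_nonempty[of T] by blast
    qed
    then show ?thesis
      using set_rtree_elim_forest[OF that] assms(3) by blast
  qed
  have "verts G \<noteq> {}"
    using assms(1) by (simp add: connected_conv)
  then obtain T where T: "T |\<in>| ?F"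
    using Union_blocks[of adj xs] assms(3) by (auto simp: blocks_elim_forest)
  have "?F = {|T|}"
    using inj_on_set_rtree_elim_forest[OF symp_adj assms(2)] whole T
    by (auto simp: inj_on_def)
  moreover have "search_tree G T"
    using search_tree_elim_forest[OF assms(2) _ T] assms(3) whole[OF T] by simp
  ultimately show ?thesis
    using that by blast
qed

lemma elim_tree:
  assumes "Digraph_Component.connected G" "distinct xs" "set xs = verts G"
  shows "elim_forest adj xs = {|elim_tree adj xs|}" "search_tree G (elim_tree adj xs)"
  using elim_forest_connected[OF assms] elim_tree_eqI by metis+

text \<open>The ordering lists the root first and then the concatenated orderings of its subtrees.
  It remains to see that the root absorbs them all.\<close>

lemma search_tree_imp_elim_forest:
  assumes "search_tree (G \<restriction> U) T" "U \<subseteq> verts G" "finite (verts G)"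
  shows "\<exists>xs. distinct xs \<and> set xs = U \<and> elim_forest adj xs = {|T|}"
  using assms(1,2)
proof (induction "G \<restriction> U" T arbitrary: U rule: search_tree.induct)
  case (1 r t ts)
  have "r \<in> U"
    using 1 by simp
  have "finite (U - {r})"
    using 1(5) assms(3) by (auto intro: finite_subset)
  \<comment> \<open>An arbitrary ordering, used only to describe the components of
    \<open>U - {r}\<close> as blocks.\<close>
  then obtain zs where zs: "distinct zs" "set zs = U - {r}"
    using finite_distinct_list by blast
  have comps: "components (pre_digraph.del_vert (G \<restriction> U) r) = (\<restriction>) G ` blocks adj zs"
    using components_blocks[of zs] zs 1(5) by (auto simp: del_vert_induce)
  have sep: "separated adj S S'" if "S \<in> blocks adj zs" "S' \<in> blocks adj zs" "S \<noteq> S'" for S S'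
    using blocks_separated[OF symp_adj zs(1)] that .
  have "\<exists>xs. distinct xs \<and> set xs = S \<and> elim_forest adj xs = {|t (G \<restriction> S)|}"
    if "S \<in> blocks adj zs" for S
  proof -
    have "G \<restriction> S \<in> components (pre_digraph.del_vert (G \<restriction> U) r)"
      using that comps by simp
    moreover have "S \<subseteq> verts G"
      using that 1(5) zs(2) Union_blocks[of adj zs] by auto
    ultimately show ?thesis
      using 1(3) by blast
  qed
  moreover have "finite (blocks adj zs)"
    by (simp add: blocks_elim_forest)
  ultimately obtain xs where xs: "distinct xs" "set xs = \<Union> (blocks adj zs)"
    "fset (elim_forest adj xs) = (\<lambda>S. t (G \<restriction> S)) ` blocks adj zs"
    using elim_forest_combine[OF symp_adj _ sep, where f = "\<lambda>S. t (G \<restriction> S)"] by blast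
  then have F: "elim_forest adj xs = ts"
    using 1(4) unfolding comps by (simp add: image_image flip: fset_inject)
  have set: "set xs = U - {r}"
    using xs(2) zs(2) by (simp add: Union_blocks)
  \<comment> \<open>A subtree not adjacent to \<open>r\<close> would span a nonempty closed proper
    subset of the connected \<open>U\<close>.\<close>
  have near: "adjacent_to adj r (set_rtree T)" if "T |\<in>| elim_forest adj xs" for T
  proof (rule ccontr)
    assume far: "\<not> adjacent_to adj r (set_rtree T)"
    have T: "set_rtree T \<subseteq> U - {r}"
      using set_rtree_elim_forest[OF that] set by simp
    have "y \<in> set_rtree T" if "x \<in> set_rtree T" "y \<in> U" "adj x y" for x y
    proof -
      have "y \<noteq> r"
        using that far by (auto simp: adjacent_to_def dest: graph_symmetric)
      then obtain S where S: "S |\<in>| elim_forest adj xs" "y \<in> set_rtree S"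
        using \<open>y \<in> U\<close> set Union_blocks[of adj xs] by (auto simp: blocks_elim_forest)
      then show ?thesis
        using elim_forest_separated[OF symp_adj xs(1) \<open>T |\<in>| _\<close> S(1)] that
        by (auto simp: separated_def adjacent_to_def)
    qed
    then have "set_rtree T = U"
      using 1(1) T set_rtree_nonempty[of T] unfolding connected_induce_iff by blast
    then show False
      using T \<open>r \<in> U\<close> by blast
  qed
  have "elim_forest adj (r # xs) = {|Node r ts|}"
  proof -
    have "ffilter (\<lambda>T. adjacent_to adj r (set_rtree T)) ts = ts"
      "ffilter (\<lambda>T. \<not> adjacent_to adj r (set_rtree T)) ts = {||}"
      using near unfolding F by (auto simp: fset_eq_iff)
    then show ?thesis
      by (simp add: F)
  qed
  then show ?case
    using xs(1) set \<open>r \<in> U\<close> by (intro exI[of _ "r # xs"]) auto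
qed

lemma elim_tree_swap:
  assumes "Digraph_Component.connected G" "distinct (ps @ v # w # qs)" "set (ps @ v # w # qs) = verts G"
  shows "reach_within (parcs (rotation_graph G)) (if linked adj v w (blocks adj qs) then 1 else 0)
    (elim_tree adj (ps @ v # w # qs)) (elim_tree adj (ps @ w # v # qs))"
proof (cases "linked adj v w (blocks adj qs)")
  case True
  have "distinct (ps @ w # v # qs)" "set (ps @ w # v # qs) = verts G"
    using assms by auto
  note trees = elim_tree[OF assms] elim_tree[OF assms(1) this]
  show ?thesis
    using True forest_tubes_swap[OF symp_adj assms(2) True] trees
      forest_tubes_singleton[OF trees(1)] forest_tubes_singleton[OF trees(3)]
    by (simp add: rotation_graph_def rotation_def reach_within_step[simplified])
next
  case False
  then have "elim_forest adj (ps @ v # w # qs) = elim_forest adj (ps @ w # v # qs)"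
    by (intro elim_forest_append_cong elim_forest_swap symp_adj)
  then show ?thesis
    by (simp add: elim_tree_def)
qed

text \<open>Moving \<open>y\<close> to the front of \<open>us\<close> costs a rotation only at
  vertices linked to it when passed. Each of these lies in the block that \<open>y\<close> obtains
  over all of \<open>us @ qs\<close>.\<close>

lemma elim_tree_move:
  assumes "Digraph_Component.connected G"
  shows "\<lbrakk>distinct (ps @ us @ y # qs); set (ps @ us @ y # qs) = verts G\<rbrakk> \<Longrightarrow>
    reach_within (parcs (rotation_graph G)) (card (set us \<inter> top_block adj y (blocks adj (us @ qs))))
      (elim_tree adj (ps @ us @ y # qs)) (elim_tree adj (ps @ y # us @ qs))"
proof (induction us arbitrary: ps)
  case (Cons u us)
  let ?R = "reach_within (parcs (rotation_graph G))" and ?B = "blocks adj (us @ qs)"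
  let ?k = "if linked adj u y ?B then 1 else 0 :: nat"
  have "?R (card (set us \<inter> top_block adj y ?B) + ?k)
    (elim_tree adj (ps @ (u # us) @ y # qs)) (elim_tree adj (ps @ y # (u # us) @ qs))"
  proof (rule reach_within_trans)
    show "?R (card (set us \<inter> top_block adj y ?B))
      (elim_tree adj (ps @ (u # us) @ y # qs)) (elim_tree adj (ps @ u # y # us @ qs))"
      using Cons.IH[of "ps @ [u]"] Cons.prems by simp
    show "?R ?k (elim_tree adj (ps @ u # y # us @ qs)) (elim_tree adj (ps @ y # (u # us) @ qs))"
      using elim_tree_swap[OF assms, of ps u y "us @ qs"] Cons.prems by auto
  qed
  moreover have "card (set us \<inter> top_block adj y ?B) + ?k \<le>
    card (set (u # us) \<inter> top_block adj y (blocks adj ((u # us) @ qs)))"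
  proof (cases "linked adj u y ?B")
    case True
    \<comment> \<open>By distinctness \<open>u\<close> is not in \<open>us\<close>, so it raises the
      count by one.\<close>
    then have "insert u (set us \<inter> top_block adj y ?B) \<subseteq>
        set (u # us) \<inter> top_block adj y (blocks adj ((u # us) @ qs))"
      by (auto simp: top_block_merge linked_commute[OF symp_adj, of y u]) (simp add: top_block_def)
    then have "card (insert u (set us \<inter> top_block adj y ?B)) \<le>
        card (set (u # us) \<inter> top_block adj y (blocks adj ((u # us) @ qs)))"
      by (intro card_mono) auto
    then show ?thesis
      using Cons.prems True by simp
  next
    case False
    then show ?thesis
      by (auto simp: top_block_merge linked_commute[OF symp_adj, of y u] intro!: card_mono)
  qed
  ultimately show ?case
    by (rule reach_within_mono)
qed simp

text \<open>Once \<open>y\<close> is in place it joins the prefix \<open>ps\<close>, and the rest is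
  sorted by induction. The block of \<open>y\<close> depends only on the set of remaining vertices,
  so the cost can be read off the target ordering.\<close>

lemma elim_tree_sort:
  assumes "Digraph_Component.connected G"
  shows "\<lbrakk>distinct (ps @ zs); set (ps @ zs) = verts G; distinct ys; set ys = set zs\<rbrakk> \<Longrightarrow>
    reach_within (parcs (rotation_graph G)) (sort_cost adj ys)
      (elim_tree adj (ps @ zs)) (elim_tree adj (ps @ ys))"
proof (induction ys arbitrary: ps zs)
  case (Cons y ys)
  let ?R = "reach_within (parcs (rotation_graph G))"
  obtain us qs where zs: "zs = us @ y # qs"
    using Cons.prems(4) by (metis list.set_intros(1) split_list)
  have ys: "set ys = set (us @ qs)"
    using Cons.prems zs by auto
  then have "blocks adj ys = blocks adj (us @ qs)"
    using Cons.prems zs by (intro blocks_permute symp_adj) (subst set_eq_iff_mset_eq_distinct[symmetric], auto)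
  then have "card (set us \<inter> top_block adj y (blocks adj (us @ qs))) \<le> card (top_block adj y (blocks adj ys))"
    by (auto intro!: card_mono)
  then have "?R (card (top_block adj y (blocks adj ys)))
      (elim_tree adj (ps @ zs)) (elim_tree adj (ps @ y # us @ qs))"
    using elim_tree_move[OF assms, of ps us y qs] Cons.prems unfolding zs by (blast intro: reach_within_mono)
  moreover have "?R (sort_cost adj ys) (elim_tree adj ((ps @ [y]) @ us @ qs)) (elim_tree adj ((ps @ [y]) @ ys))"
    using Cons.prems zs ys by (intro Cons.IH) auto
  ultimately show ?case
    by (auto dest: reach_within_trans)
qed simp

end

section \<open>The diameter bound\<close>

lemma sym_rotation_graph: "sym (parcs (rotation_graph G))"
  by (auto simp: rotation_graph_def rotation_def Un_commute intro!: symI)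

theorem theorem13:
  fixes G :: "('a, 'b) pre_digraph" and n td :: nat
  assumes "graph G"
    and "Digraph_Component.connected G"
    and "card (verts G) = n"
    and "tree_depth G \<le> td"
  shows "associahedron_diameter G \<le> ereal (real (2 * td * n))"
proof -
  interpret graph G by fact
  let ?R = "parcs (rotation_graph G)"
  have order: "\<exists>xs. distinct xs \<and> set xs = verts G \<and> elim_forest adj xs = {|T|}" if "search_tree G T" for T
    using search_tree_imp_elim_forest[of "verts G" T] that by simp
  \<comment> \<open>Some search tree exists, so the minimum in \<open>tree_depth\<close> is
    attained.\<close>
  obtain xs where "distinct xs" "set xs = verts G"
    using finite_distinct_list[OF finite_verts] by blast
  then have "\<exists>h T. search_tree G T \<and> tree_height T = h"
    using elim_tree(2)[OF assms(2)] by blast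
  then have "\<exists>T. search_tree G T \<and> tree_height T = tree_depth G"
    unfolding tree_depth_def by (rule LeastI_ex)
  then obtain T where T: "search_tree G T" "tree_height T \<le> td"
    using assms(4) by auto
  obtain ys where ys: "distinct ys" "set ys = verts G" "elim_forest adj ys = {|T|}"
    using order[OF T(1)] by blast
  \<comment> \<open>The forest of \<open>ys\<close> is the single spanning tree \<open>T\<close>, so
    the sum in \<open>sort_cost_le\<close> is the height of \<open>T\<close> times
    \<open>n\<close>.\<close>
  have "set_rtree T = verts G"
    using Union_blocks[of adj ys] ys by (simp add: blocks_elim_forest)
  then have "sort_cost adj ys \<le> tree_height T * n"
    using sort_cost_le[OF symp_adj ys(1)] ys(3) assms(3) by simp
  also have "\<dots> \<le> td * n"
    using T(2) by simp
  finally have cost: "sort_cost adj ys \<le> td * n" .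
  have to_T: "reach_within ?R (td * n) S T" if S: "search_tree G S" for S
  proof -
    obtain zs where zs: "distinct zs" "set zs = verts G" "elim_forest adj zs = {|S|}"
      using order[OF S] by blast
    then have "reach_within ?R (sort_cost adj ys) S T"
      using elim_tree_sort[OF assms(2), of "[]" zs ys] ys by (simp add: elim_tree_eqI)
    then show ?thesis
      using cost by (rule reach_within_mono)
  qed
  have "wf_digraph.\<mu> (with_proj (rotation_graph G)) (\<lambda>_. 1) S S' \<le> ereal (real (2 * td * n))"
    if "S \<in> verts (with_proj (rotation_graph G))" "S' \<in> verts (with_proj (rotation_graph G))" for S S'
  proof (rule distance_le[OF wf_digraph_rotation_graph that(1)])
    have "reach_within ?R (td * n) S T" "reach_within ?R (td * n) T S'"
      using that to_T[of S] reach_within_sym[OF sym_rotation_graph to_T[of S']]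
      by (simp_all add: rotation_graph_def)
    then have "reach_within ?R (td * n + td * n) S S'"
      by (rule reach_within_trans)
    then show "reach_within (arcs_ends (with_proj (rotation_graph G))) (2 * td * n) S S'"
      by (simp add: mult_2 add_mult_distrib)
  qed
  then show ?thesis
    unfolding associahedron_diameter_def graph_diameter_def by (intro SUP_least)
qed

end
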